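(* Let $\mathcal{G}=(\mathcal{V},\mathcal{E})$ be a connected finite undirected graph with vertex set $\mathcal{V}=\{1,\dots,n\}$, and let $\mathbf{N}_i$ be the set of neighbors of vertex $i$. Let $\xi_i>0$, $\zeta_i\in\mathbb{R}$ and $p_i^d\in\mathbb{R}$ be given for $i=1,\dots,n$. Let $v_i(t),u_i(t)$, $t\ge 0$, be the solutions of $$\dot v_i=\sum_{j\in\mathbf{N}_i}(v_j-v_i),\quad v_i(0)=\frac{1}{2\xi_i},\qquad \dot u_i=\sum_{j\in\mathbf{N}_i}(u_j-u_i),\quad u_i(0)=p_i^d+\frac{\zeta_i}{2\xi_i},\qquad i=1,\dots,n,$$ and let $v_i^\ast=\lim_{t\to\infty}v_i(t)$ and $u_i^\ast=\lim_{t\to\infty}u_i(t)$ be the converged values. Then the Lagrange parameter $\lambda^\ast$ of the optimal generation problem is given, for every $i\in\{1,\dots,n\}$, by $$\lambda^\ast=-\frac{u_i^\ast}{v_i^\ast},$$ that is, $$-\frac{u_i^\ast}{v_i^\ast}=-\frac{\sum_{k=1}^n\left[p_k^d+\frac{\zeta_k}{2\xi_k}\right]}{\sum_{k=1}^n\frac{1}{2\xi_k}}.$$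
   Context: The optimal generation problem is: minimize $\sum_{i=1}^n\left(\xi_i(p_i^g)^2+\zeta_i p_i^g+\eta_i\right)$ over $(p_1^g,\dots,p_n^g)\in\mathbb{R}^n$ subject to $\sum_{i=1}^n p_i^g=\sum_{i=1}^n p_i^d$, where $\xi_i>0,\zeta_i,\eta_i$ are real cost parameters and $p_i^d$ is the desired energy of node $i$. Its Lagrange parameter is the real number $\lambda$ such that, together with some $(p_i^g)_i$, one has $2\xi_ip_i^g+\zeta_i+\lambda=0$ for all $i$ and $\sum_i p_i^g=\sum_i p_i^d$; equivalently $\lambda=-\frac{\sum_{k=1}^n[p_k^d+\zeta_k/(2\xi_k)]}{\sum_{k=1}^n 1/(2\xi_k)}$. The limits $v_i^\ast,u_i^\ast$ exist because the graph is connected (standard average consensus). *)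

theory Defs
  imports "HOL-Analysis.Analysis" "Graph_Theory.Pair_Digraph" "Graph_Theory.Digraph_Component"
begin

text \<open>
  An undirected graph is a symmetric arc set over a finite vertex set
  (\<^locale>\<open>pair_pseudo_graph\<close>). Loops are not excluded; they contribute
  zero to the consensus dynamics.
\<close>

definition neighbors :: "'a pair_pre_digraph \<Rightarrow> 'a \<Rightarrow> 'a set" where
  "neighbors G i = {j. i \<rightarrow>\<^bsub>with_proj G\<^esub> j}"

text \<open>
  Vertex \<open>i\<close> at time \<open>t\<close> has state \<open>x i t\<close>; the derivative at \<open>0\<close> is one-sided.
\<close>

definition consensus_solution ::
  "'a pair_pre_digraph \<Rightarrow> ('a \<Rightarrow> real) \<Rightarrow> ('a \<Rightarrow> real \<Rightarrow> real) \<Rightarrow> bool" where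
  "consensus_solution G x0 x \<longleftrightarrow>
     (\<forall>i\<in>pverts G. x i 0 = x0 i \<and>
        (\<forall>t\<ge>0. (x i has_real_derivative (\<Sum>j\<in>neighbors G i. x j t - x i t)) (at t within {0..})))"

definition generation_cost ::
  "nat \<Rightarrow> (nat \<Rightarrow> real) \<Rightarrow> (nat \<Rightarrow> real) \<Rightarrow> (nat \<Rightarrow> real) \<Rightarrow> (nat \<Rightarrow> real) \<Rightarrow> real" where
  "generation_cost n \<xi> \<zeta> \<eta> pg = (\<Sum>i=1..n. \<xi> i * (pg i)\<^sup>2 + \<zeta> i * pg i + \<eta> i)"

definition feasible_generation ::
  "nat \<Rightarrow> (nat \<Rightarrow> real) \<Rightarrow> (nat \<Rightarrow> real) \<Rightarrow> bool" where
  "feasible_generation n pd pg \<longleftrightarrow> (\<Sum>i=1..n. pg i) = (\<Sum>i=1..n. pd i)"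

text \<open>
  First-order conditions for minimizing \<^const>\<open>generation_cost\<close> subject to
  \<^const>\<open>feasible_generation\<close>, with Lagrangian
  \<open>generation_cost n \<xi> \<zeta> \<eta> pg + lam * ((\<Sum>i=1..n. pg i) - (\<Sum>i=1..n. pd i))\<close>;
  the constants \<open>\<eta>\<close> vanish on differentiation.
\<close>

definition lagrange_conditions ::
  "nat \<Rightarrow> (nat \<Rightarrow> real) \<Rightarrow> (nat \<Rightarrow> real) \<Rightarrow> (nat \<Rightarrow> real) \<Rightarrow> (nat \<Rightarrow> real) \<Rightarrow> real \<Rightarrow> bool" where
  "lagrange_conditions n \<xi> \<zeta> pd pg lam \<longleftrightarrow>
     (\<forall>i\<in>{1..n}. 2 * \<xi> i * pg i + \<zeta> i + lam = 0) \<and> feasible_generation n pd pg"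

definition is_lagrange_parameter ::
  "nat \<Rightarrow> (nat \<Rightarrow> real) \<Rightarrow> (nat \<Rightarrow> real) \<Rightarrow> (nat \<Rightarrow> real) \<Rightarrow> real \<Rightarrow> bool" where
  "is_lagrange_parameter n \<xi> \<zeta> pd lam \<longleftrightarrow> (\<exists>pg. lagrange_conditions n \<xi> \<zeta> pd pg lam)"

lemma lagrange_conditions_imp_optimal:
  assumes "\<And>i. i \<in> {1..n} \<Longrightarrow> \<xi> i > 0"
    and kkt: "lagrange_conditions n \<xi> \<zeta> pd pg lam" and q: "feasible_generation n pd q"
  shows "generation_cost n \<xi> \<zeta> \<eta> pg \<le> generation_cost n \<xi> \<zeta> \<eta> q"
proof -
  have stat: "\<zeta> i = - lam - 2 * \<xi> i * pg i" if "i \<in> {1..n}" for i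
    using kkt that unfolding lagrange_conditions_def by force
  have "generation_cost n \<xi> \<zeta> \<eta> q - generation_cost n \<xi> \<zeta> \<eta> pg
      = (\<Sum>i=1..n. \<xi> i * (q i - pg i)\<^sup>2 - lam * (q i - pg i))"
    unfolding generation_cost_def sum_subtractf[symmetric]
    by (rule sum.cong[OF refl], subst (1 2) stat) (auto simp: algebra_simps power2_eq_square)
  also have "\<dots> = (\<Sum>i=1..n. \<xi> i * (q i - pg i)\<^sup>2) - lam * ((\<Sum>i=1..n. q i) - (\<Sum>i=1..n. pg i))"
    by (simp add: sum_subtractf sum_distrib_left[symmetric])
  also have "\<dots> = (\<Sum>i=1..n. \<xi> i * (q i - pg i)\<^sup>2)"
    using kkt q by (simp add: lagrange_conditions_def feasible_generation_def)
  also have "\<dots> \<ge> 0"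
    using assms(1) by (intro sum_nonneg) (simp add: less_imp_le)
  finally show ?thesis by simp
qed

end

theory Submission
  imports Defs
begin

text \<open>
  The sum of the states is conserved. The squared deviation from the mean decreases at the rate of
  the Dirichlet energy of the graph, which by the Poincare inequality of a connected graph dominates
  it. Hence all states converge exponentially to the mean of the initial states, and the number of
  vertices cancels in the quotient of two means.
\<close>

section \<open>Closed form of the Lagrange parameter\<close>

text \<open>As \<xi> is positive, stationarity fixes every generation as an affine function
  \<open>p i\<close> of \<open>lam\<close>. Feasibility then becomes a single linear equation in
  \<open>lam\<close> with slope \<open>- S\<close>, which is nonzero.\<close>

lemma is_lagrange_parameter_iff:
  assumes "n \<ge> 1" and pos: "\<And>i. i \<in> {1..n} \<Longrightarrow> \<xi> i > 0"
  shows "is_lagrange_parameter n \<xi> \<zeta> pd lam \<longleftrightarrow>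
    lam = - ((\<Sum>k=1..n. pd k + \<zeta> k / (2 * \<xi> k)) / (\<Sum>k=1..n. 1 / (2 * \<xi> k)))"
proof -
  define S where "S = (\<Sum>k=1..n. 1 / (2 * \<xi> k))"
  define Z where "Z = (\<Sum>k=1..n. \<zeta> k / (2 * \<xi> k))"
  define p where "p = (\<lambda>i. - (lam + \<zeta> i) / (2 * \<xi> i))"
  have "S > 0"
    unfolding S_def using assms by (intro sum_pos) auto
  have stationary: "2 * \<xi> i * q + \<zeta> i + lam = 0 \<longleftrightarrow> q = p i" if "i \<in> {1..n}" for i q
    using pos[OF that] by (auto simp: p_def field_simps)
  have sum_p: "(\<Sum>i=1..n. p i) = - lam * S - Z"
    by (simp add: p_def S_def Z_def sum_distrib_left sum_subtractf[symmetric]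
        diff_divide_distrib add_divide_distrib)
  have "is_lagrange_parameter n \<xi> \<zeta> pd lam \<longleftrightarrow> (\<Sum>i=1..n. p i) = (\<Sum>i=1..n. pd i)"
  proof
    assume "is_lagrange_parameter n \<xi> \<zeta> pd lam"
    then obtain q where "\<forall>i\<in>{1..n}. q i = p i" "(\<Sum>i=1..n. q i) = (\<Sum>i=1..n. pd i)"
      using stationary
      by (auto simp: is_lagrange_parameter_def lagrange_conditions_def feasible_generation_def)
    then show "(\<Sum>i=1..n. p i) = (\<Sum>i=1..n. pd i)"
      by simp
  next
    assume "(\<Sum>i=1..n. p i) = (\<Sum>i=1..n. pd i)"
    then show "is_lagrange_parameter n \<xi> \<zeta> pd lam"
      using stationary
      by (auto simp: is_lagrange_parameter_def lagrange_conditions_def feasible_generation_def)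
  qed
  also have "\<dots> \<longleftrightarrow> lam = - (((\<Sum>i=1..n. pd i) + Z) / S)"
    unfolding sum_p using \<open>S > 0\<close> by (auto simp: field_simps)
  finally show ?thesis
    by (simp add: S_def Z_def sum.distrib)
qed

section \<open>Dirichlet energy and the Poincare inequality\<close>

text \<open>Arcs come in both directions, so an undirected edge between distinct vertices counts
  twice. This matches the factor 2 from differentiating a square.\<close>

definition dirichlet_energy :: "'a pair_pre_digraph \<Rightarrow> ('a \<Rightarrow> real) \<Rightarrow> real" where
  "dirichlet_energy G x = (\<Sum>(i, j)\<in>parcs G. (x j - x i)\<^sup>2)"

lemma dirichlet_energy_nonneg: "dirichlet_energy G x \<ge> 0"
  by (auto simp: dirichlet_energy_def intro: sum_nonneg)

context pair_pseudo_graph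
begin

lemma finite_neighbors: "finite (neighbors G i)"
  by (rule finite_subset[OF _ pair_finite_verts])
    (auto simp: neighbors_def dest: in_arcsD2)

lemma sum_neighbors:
  "(\<Sum>i\<in>pverts G. \<Sum>j\<in>neighbors G i. f i j) = (\<Sum>(i, j)\<in>parcs G. f i j)"
proof -
  have "parcs G = Sigma (pverts G) (neighbors G)"
    by (auto simp: neighbors_def dest: in_arcsD1)
  then show ?thesis
    by (simp add: sum.Sigma pair_finite_verts finite_neighbors)
qed

text \<open>Undirectedness enters here: reversing arcs is an involution on
  \<open>parcs G\<close>.\<close>

lemma sum_parcs_swap:
  "(\<Sum>(i, j)\<in>parcs G. f i j) = (\<Sum>(i, j)\<in>parcs G. f j i)"
proof -
  have "sym (parcs G)"
    using pair_sym_arcs by (simp add: symmetric_def)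
  then show ?thesis
    by (intro sum.reindex_bij_witness[of _ prod.swap prod.swap]) (auto dest: symD)
qed

text \<open>The contributions of an arc and its reverse cancel. Along a solution this conserves the
  sum of the states.\<close>

lemma sum_laplacian_eq_zero:
  fixes x :: "'a \<Rightarrow> real"
  shows "(\<Sum>i\<in>pverts G. \<Sum>j\<in>neighbors G i. x j - x i) = 0"
  unfolding sum_neighbors using sum_parcs_swap[of "\<lambda>i j. x i"]
  by (simp add: split_beta sum_subtractf)

text \<open>Discrete integration by parts: when the arc sum is added to its reversed copy, each arc
  contributes \<open>- (x j - x i)\<^sup>2\<close>.\<close>

lemma sum_mult_laplacian:
  "2 * (\<Sum>i\<in>pverts G. x i * (\<Sum>j\<in>neighbors G i. x j - x i)) = - dirichlet_energy G x"
proof -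
  let ?A = "\<Sum>(i, j)\<in>parcs G. x i * (x j - x i)"
  have "(\<Sum>i\<in>pverts G. x i * (\<Sum>j\<in>neighbors G i. x j - x i)) = ?A"
    by (simp add: sum_distrib_left sum_neighbors)
  moreover have "?A = (\<Sum>(i, j)\<in>parcs G. x j * (x i - x j))"
    by (rule sum_parcs_swap)
  moreover have "?A + (\<Sum>(i, j)\<in>parcs G. x j * (x i - x j)) = - dirichlet_energy G x"
    unfolding dirichlet_energy_def sum.distrib[symmetric] sum_negf[symmetric]
    by (intro sum.cong) (auto simp: power2_eq_square algebra_simps)
  ultimately show ?thesis
    by simp
qed

lemma arc_diff_le_dirichlet_energy:
  assumes "(i, j) \<in> parcs G"
  shows "(x i - x j)\<^sup>2 \<le> dirichlet_energy G x"
  using member_le_sum[OF assms, of "\<lambda>(i, j). (x j - x i)\<^sup>2"] pair_finite_arcs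
  by (simp add: dirichlet_energy_def power2_commute split_beta)

text \<open>Induction along a walk. By
  \<open>(a + b)\<^sup>2 \<le> 2 * a\<^sup>2 + 2 * b\<^sup>2\<close>, one more arc turns
  \<open>K\<close> into \<open>2 * K + 2\<close>; the constant depends on the walk but not on
  \<open>x\<close>.\<close>

lemma reachable_diff_le_dirichlet_energy:
  assumes "i \<rightarrow>\<^sup>*\<^bsub>with_proj G\<^esub> j"
  shows "\<exists>K\<ge>0. \<forall>x. (x i - x j)\<^sup>2 \<le> K * dirichlet_energy G x"
  using assms
proof (induction rule: reachable_induct)
  case base
  show ?case by (intro exI[of _ 0]) auto
next
  case (step j k)
  then obtain K where K: "K \<ge> 0" "\<And>x. (x i - x j)\<^sup>2 \<le> K * dirichlet_energy G x"
    by blast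
  have "(x i - x k)\<^sup>2 \<le> (2 * K + 2) * dirichlet_energy G x" for x
  proof -
    have "(x i - x k)\<^sup>2 \<le> 2 * (x i - x j)\<^sup>2 + 2 * (x j - x k)\<^sup>2"
      using sum_squares_bound[of "x i - x j" "x j - x k"]
      by (simp add: power2_eq_square algebra_simps)
    also have "\<dots> \<le> 2 * (K * dirichlet_energy G x) + 2 * dirichlet_energy G x"
      using K(2) arc_diff_le_dirichlet_energy[of j k x] step.hyps(2)
      by (intro add_mono mult_left_mono) auto
    finally show ?thesis by (simp add: algebra_simps)
  qed
  then show ?case
    using K(1) by (intro exI[of _ "2 * K + 2"]) auto
qed

text \<open>If the values sum to zero, \<open>card (pverts G) * x i\<close> is the sum of the
  differences \<open>x i - x j\<close>, and connectedness bounds each of these by the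
  energy.\<close>

lemma poincare_inequality:
  assumes "Digraph_Component.connected (with_proj G)"
  obtains C where "C > 0"
    "\<And>x. (\<Sum>i\<in>pverts G. x i) = 0 \<Longrightarrow> (\<Sum>i\<in>pverts G. (x i)\<^sup>2) \<le> C * dirichlet_energy G x"
proof -
  let ?N = "real (card (pverts G))"
  have "\<forall>i\<in>pverts G. \<forall>j\<in>pverts G. i \<rightarrow>\<^sup>*\<^bsub>with_proj G\<^esub> j" and "pverts G \<noteq> {}"
    \<comment> \<open>Connectedness means strong connectedness of the symmetric closure, which has
      the same reachability as \<open>G\<close> itself.\<close>
    using assms reachable_mk_symmetric_eq[OF pair_sym_arcs]
    by (auto simp: Digraph_Component.connected_def strongly_connected_def)
  then have "\<forall>i\<in>pverts G. \<forall>j\<in>pverts G. \<exists>K\<ge>0. \<forall>x. (x i - x j)\<^sup>2 \<le> K * dirichlet_energy G x"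
    using reachable_diff_le_dirichlet_energy by blast
  then obtain K where K: "\<And>i j. i \<in> pverts G \<Longrightarrow> j \<in> pverts G \<Longrightarrow> K i j \<ge> 0"
    "\<And>i j x. i \<in> pverts G \<Longrightarrow> j \<in> pverts G \<Longrightarrow> (x i - x j)\<^sup>2 \<le> K i j * dirichlet_energy G x"
    by metis
  have N: "?N \<ge> 1"
    using \<open>pverts G \<noteq> {}\<close> pair_finite_verts by (simp add: Suc_le_eq card_gt_0_iff)
  define C where "C = ?N * (\<Sum>i\<in>pverts G. \<Sum>j\<in>pverts G. K i j)"
  have "C \<ge> 0"
    using K(1) by (auto simp: C_def intro!: sum_nonneg mult_nonneg_nonneg)
  have "(\<Sum>i\<in>pverts G. (x i)\<^sup>2) \<le> (C + 1) * dirichlet_energy G x"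
    if mean: "(\<Sum>i\<in>pverts G. x i) = 0" for x
  proof -
    have "(x i)\<^sup>2 \<le> ?N * (\<Sum>j\<in>pverts G. K i j * dirichlet_energy G x)" if "i \<in> pverts G" for i
    proof -
      have "(x i)\<^sup>2 \<le> (?N * x i)\<^sup>2"
        using N by (auto simp: power_mult_distrib mult_le_cancel_right1)
      also have "?N * x i = (\<Sum>j\<in>pverts G. x i - x j)"
        using mean by (simp add: sum_subtractf)
      \<comment> \<open>Cauchy-Schwarz against the constant 1.\<close>
      also have "\<dots>\<^sup>2 \<le> (\<Sum>j\<in>pverts G. (x i - x j)\<^sup>2) * ?N"
        by (rule sum_squared_le_sum_of_squares)
      also have "\<dots> \<le> (\<Sum>j\<in>pverts G. K i j * dirichlet_energy G x) * ?N"
        using K(2) that by (intro mult_right_mono sum_mono) auto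
      finally show ?thesis by (simp add: mult.commute)
    qed
    then have "(\<Sum>i\<in>pverts G. (x i)\<^sup>2) \<le>
        (\<Sum>i\<in>pverts G. ?N * (\<Sum>j\<in>pverts G. K i j * dirichlet_energy G x))"
      by (rule sum_mono)
    also have "\<dots> = C * dirichlet_energy G x"
      by (simp add: C_def sum_distrib_left sum_distrib_right mult.assoc)
    \<comment> \<open>\<open>C\<close> may be 0, for instance on a single vertex; adding 1 makes the
      constant positive, so that its inverse can serve as a decay rate.\<close>
    also have "\<dots> \<le> (C + 1) * dirichlet_energy G x"
      by (intro mult_right_mono dirichlet_energy_nonneg) simp
    finally show ?thesis .
  qed
  with \<open>C \<ge> 0\<close> show ?thesis
    by (intro that[of "C + 1"]) auto
qed

end

section \<open>Decay from a differential inequality\<close>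

text \<open>The one-sided derivative at 0 supplies continuity there; at positive times the
  derivative is two-sided and the mean value argument applies.\<close>

lemma decreasing_from_zero:
  fixes f :: "real \<Rightarrow> real"
  assumes der: "\<And>t. t \<ge> 0 \<Longrightarrow> (f has_real_derivative f' t) (at t within {0..})"
    and nonpos: "\<And>t. t \<ge> 0 \<Longrightarrow> f' t \<le> 0"
    and "t \<ge> 0"
  shows "f t \<le> f 0"
proof (rule DERIV_nonpos_imp_decreasing_open[OF \<open>t \<ge> 0\<close>])
  show "\<exists>y. (f has_real_derivative y) (at s) \<and> y \<le> 0" if "0 < s" for s
  proof -
    have "at s within {0..} = at s"
      using that by (intro at_within_interior) simp
    with der[of s] nonpos[of s] that show ?thesis by auto
  qed
  show "continuous_on {0..t} f"
    by (rule continuous_on_subset[where s = "{0..}"])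
      (auto intro!: DERIV_continuous_on der)
qed

text \<open>An integrating factor turns the hypothesis into monotonicity of \<open>V t * exp (k * t)\<close>.\<close>

lemma exponential_decay_tendsto_zero:
  fixes V :: "real \<Rightarrow> real"
  assumes der: "\<And>t. t \<ge> 0 \<Longrightarrow> (V has_real_derivative V' t) (at t within {0..})"
    and le: "\<And>t. t \<ge> 0 \<Longrightarrow> V' t \<le> - k * V t"
    and nonneg: "\<And>t. V t \<ge> 0" and "k > 0"
  shows "(V \<longlongrightarrow> 0) at_top"
proof (rule tendsto_sandwich[OF _ _ tendsto_const])
  have mono: "V t * exp (k * t) \<le> V 0 * exp (k * 0)" if "t \<ge> 0" for t
  proof (rule decreasing_from_zero[OF _ _ that])
    show "((\<lambda>t. V t * exp (k * t)) has_real_derivative (V' t + k * V t) * exp (k * t))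
        (at t within {0..})" if "t \<ge> 0" for t
      by (auto intro!: derivative_eq_intros der that simp: algebra_simps)
    show "(V' t + k * V t) * exp (k * t) \<le> 0" if "t \<ge> 0" for t
      using le[OF that] by (intro mult_nonpos_nonneg) auto
  qed
  have "V t \<le> V 0 * exp (- (k * t))" if "t \<ge> 0" for t
    using mono[OF that] by (simp add: exp_minus pos_le_divide_eq flip: divide_inverse)
  then show "\<forall>\<^sub>F t in at_top. V t \<le> V 0 * exp (- (k * t))"
    by (intro eventually_at_top_linorderI)
  show "((\<lambda>t. V 0 * exp (- (k * t))) \<longlongrightarrow> 0) at_top"
    using \<open>k > 0\<close>
    by (intro tendsto_mult_right_zero filterlim_compose[OF exp_at_bot])
      (auto simp: filterlim_uminus_at_bot intro!: filterlim_tendsto_pos_mult_at_top[OF tendsto_const] filterlim_ident)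
qed (auto simp: nonneg)

section \<open>Convergence to the mean\<close>

theorem (in pair_pseudo_graph) average_consensus:
  assumes conn: "Digraph_Component.connected (with_proj G)"
    and sol: "consensus_solution G x0 x" and i: "i \<in> pverts G"
  shows "(x i \<longlongrightarrow> (\<Sum>j\<in>pverts G. x0 j) / card (pverts G)) at_top"
proof -
  define m where "m = (\<Sum>j\<in>pverts G. x0 j) / card (pverts G)"
  \<comment> \<open>Subtracting a constant leaves all differences unchanged, so \<open>y\<close>
    obeys the same equations, now with zero sum.\<close>
  define y where "y = (\<lambda>j t. x j t - m)"
  define V where "V = (\<lambda>t. \<Sum>j\<in>pverts G. (y j t)\<^sup>2)"
  obtain C where C: "C > 0"
    "\<And>z. (\<Sum>i\<in>pverts G. z i) = 0 \<Longrightarrow> (\<Sum>i\<in>pverts G. (z i)\<^sup>2) \<le> C * dirichlet_energy G z"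
    using poincare_inequality[OF conn] by blast
  have card: "card (pverts G) > 0"
    using i pair_finite_verts by (auto simp: card_gt_0_iff)
  have y_der: "(y j has_real_derivative (\<Sum>k\<in>neighbors G j. y k t - y j t)) (at t within {0..})"
    if "j \<in> pverts G" "t \<ge> 0" for j t
    using sol that unfolding y_def consensus_solution_def
    by (auto intro!: derivative_eq_intros)
  have y_mean: "(\<Sum>j\<in>pverts G. y j t) = 0" if "t \<ge> 0" for t
  proof -
    have "((\<lambda>t. \<Sum>j\<in>pverts G. y j t) has_real_derivative
        (\<Sum>j\<in>pverts G. \<Sum>k\<in>neighbors G j. y k t - y j t)) (at t within {0..})" if "t \<ge> 0" for t
      using that by (intro DERIV_sum y_der)
    then have "((\<lambda>t. \<Sum>j\<in>pverts G. y j t) has_real_derivative 0) (at t within {0..})"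
      if "t \<ge> 0" for t
      using that unfolding sum_laplacian_eq_zero .
    then obtain c where c: "\<And>t. t \<in> {0..} \<Longrightarrow> (\<Sum>j\<in>pverts G. y j t) = c"
      using has_field_derivative_zero_constant[of "{0..}" "\<lambda>t. \<Sum>j\<in>pverts G. y j t"] by auto
    \<comment> \<open>The conserved value is read off at time 0; it vanishes by the choice of
      \<open>m\<close>.\<close>
    have "c = (\<Sum>j\<in>pverts G. x0 j) - card (pverts G) * m"
      using c[of 0] sol by (simp add: y_def consensus_solution_def sum_subtractf)
    then show ?thesis
      using card c[of t] that by (simp add: m_def)
  qed
  have "(V \<longlongrightarrow> 0) at_top"
  \<comment> \<open>The derivative of \<open>V\<close> is minus the energy, hence at most
    \<open>- V t / C\<close> by the Poincare inequality.\<close>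
  proof (rule exponential_decay_tendsto_zero[where k = "1 / C"])
    show "(V has_real_derivative - dirichlet_energy G (\<lambda>j. y j t)) (at t within {0..})"
      if "t \<ge> 0" for t
    proof -
      have "(V has_real_derivative
          (\<Sum>j\<in>pverts G. 2 * (y j t * (\<Sum>k\<in>neighbors G j. y k t - y j t)))) (at t within {0..})"
        unfolding V_def using that
        by (intro DERIV_sum) (auto intro!: derivative_eq_intros y_der)
      then show ?thesis
        using sum_mult_laplacian[of "\<lambda>j. y j t"] by (simp add: sum_distrib_left)
    qed
    show "- dirichlet_energy G (\<lambda>j. y j t) \<le> - (1 / C) * V t" if "t \<ge> 0" for t
      using C(2)[OF y_mean[OF that]] C(1) by (simp add: V_def field_simps)
  qed (use C(1) in \<open>auto simp: V_def sum_nonneg\<close>)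
  have "((\<lambda>t. (y i t)\<^sup>2) \<longlongrightarrow> 0) at_top"
    by (rule tendsto_sandwich[OF _ _ tendsto_const \<open>(V \<longlongrightarrow> 0) at_top\<close>])
      (auto simp: V_def intro!: always_eventually member_le_sum i pair_finite_verts)
  then have "(y i \<longlongrightarrow> 0) at_top"
    by simp
  then show ?thesis
    using tendsto_add[of "y i" 0 at_top "\<lambda>_. m" m] by (simp add: y_def m_def)
qed

text \<open>Unique existence justifies speaking of the Lagrange parameter; existence of the limits
  belongs to the conclusion.\<close>

theorem mainTheorem1:
  fixes n :: nat
    and G :: "nat pair_pre_digraph"
    and \<xi> \<zeta> pd :: "nat \<Rightarrow> real"
    and v u :: "nat \<Rightarrow> real \<Rightarrow> real"
  assumes "pair_pseudo_graph G"
    and "pverts G = {1..n}"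
    and "Digraph_Component.connected (with_proj G)"
    and "\<And>i. i \<in> {1..n} \<Longrightarrow> \<xi> i > 0"
    and "consensus_solution G (\<lambda>i. 1 / (2 * \<xi> i)) v"
    and "consensus_solution G (\<lambda>i. pd i + \<zeta> i / (2 * \<xi> i)) u"
  shows "(\<exists>!lam. is_lagrange_parameter n \<xi> \<zeta> pd lam) \<and>
         (\<forall>i\<in>{1..n}. \<exists>v_lim u_lim.
           (v i \<longlongrightarrow> v_lim) at_top \<and> (u i \<longlongrightarrow> u_lim) at_top \<and> v_lim \<noteq> 0 \<and>
           is_lagrange_parameter n \<xi> \<zeta> pd (- (u_lim / v_lim)) \<and>
           - (u_lim / v_lim) =
             - ((\<Sum>k=1..n. pd k + \<zeta> k / (2 * \<xi> k)) / (\<Sum>k=1..n. 1 / (2 * \<xi> k))))"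
proof -
  interpret pair_pseudo_graph G by fact
  \<comment> \<open>Connectedness includes nonemptiness, which yields
    \<open>n \<ge> 1\<close>.\<close>
  have "pverts G \<noteq> {}"
    using assms(3) by (simp add: Digraph_Component.connected_def strongly_connected_def)
  then have n: "n \<ge> 1"
    using assms(2) by simp
  let ?U = "\<Sum>k=1..n. pd k + \<zeta> k / (2 * \<xi> k)" and ?V = "\<Sum>k=1..n. 1 / (2 * \<xi> k)"
  have lagrange_iff: "is_lagrange_parameter n \<xi> \<zeta> pd lam \<longleftrightarrow> lam = - (?U / ?V)" for lam
    using n assms(4) by (rule is_lagrange_parameter_iff)
  have "?V > 0"
    using n assms(4) by (intro sum_pos) auto
  have lims: "(v i \<longlongrightarrow> ?V / n) at_top" "(u i \<longlongrightarrow> ?U / n) at_top" if "i \<in> {1..n}" for i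
    using average_consensus[OF assms(3,5)] average_consensus[OF assms(3,6)] assms(2) that by simp_all
  have "?V / n \<noteq> 0" "- ((?U / n) / (?V / n)) = - (?U / ?V)"
    using n \<open>?V > 0\<close> by auto
  with lims show ?thesis
    unfolding lagrange_iff by (intro conjI ballI exI ex1I[of _ "- (?U / ?V)"] refl)
qed

end
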